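(* $\mathcal P(\mathcal T^2)$ equals the convex hull of the points \[ (0,0),\ \left(\tfrac12,\tfrac14\right),\ \left(\tfrac34,\tfrac{9}{16}\right),\ (1,1),\ \left(\tfrac14,\tfrac12\right),\ \left(\tfrac{9}{16},\tfrac34\right). \]
   Context: For $k\in\mathbb N$, $T^2_k$ is the two-dimensional torus with vertex set $[k]^2$, where two vertices are adjacent iff they differ in exactly one coordinate $j$ and there $x_j\equiv y_j\pm1\pmod k$; $\mathcal T^2=(T^2_k)_{k\ge1}$. A balanced colouring is a partition of the vertex set into $R,B$ with $|R|=|B|$. For a vertex set $S$, $P_2(S)$ is the probability that a simple random walk (moving to a uniformly random neighbour each step) started at a uniformly random vertex of $S$ is in $S$ after steps 1 and 2. For a sequence $\mathcal G=(G_k)$, $(x,y)\in\mathcal P(\mathcal G)$ iff for every $\epsilon>0$ there are $k$ and a balanced colouring $(R,B)$ of $G_k$ with $|P_2(R)-x|<\epsilon$ and $|P_2(B)-y|<\epsilon$. *)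

theory Defs
  imports "HOL-Probability.Probability" "HOL-Number_Theory.Cong" "Graph_Theory.Pair_Digraph"
begin

text \<open>Finite simple graphs are symmetric loop-free digraphs, i.e. instances of
  \<^locale>\<open>pair_graph\<close>, so every edge is present as a pair of opposite arcs.\<close>

definition torus2 :: "nat \<Rightarrow> (int \<times> int) pair_pre_digraph" where
  "torus2 k = \<lparr> pverts = {1..int k} \<times> {1..int k},
     parcs = {((x1, x2), (y1, y2)).
       (x1, x2) \<in> {1..int k} \<times> {1..int k} \<and> (y1, y2) \<in> {1..int k} \<times> {1..int k} \<and>
       (x1 \<noteq> y1 \<and> x2 = y2 \<and> ([x1 = y1 + 1] (mod int k) \<or> [x1 = y1 - 1] (mod int k)) \<or>
        x1 = y1 \<and> x2 \<noteq> y2 \<and> ([x2 = y2 + 1] (mod int k) \<or> [x2 = y2 - 1] (mod int k)))} \<rparr>"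

lemma pair_graph_torus2: "pair_graph (torus2 k)"
proof -
  have "parcs (torus2 k) \<subseteq> pverts (torus2 k) \<times> pverts (torus2 k)"
    by (auto simp: torus2_def)
  moreover have "finite (pverts (torus2 k))"
    by (simp add: torus2_def)
  ultimately have fin: "finite (parcs (torus2 k))"
    by (auto intro: finite_subset)
  have "sym (parcs (torus2 k))"
    by (rule symI) (auto simp: torus2_def cong_iff_dvd_diff dvd_diff_commute algebra_simps)
  then have sym: "symmetric (with_proj (torus2 k))"
    by (simp add: symmetric_def arcs_ends_conv)
  show ?thesis
    by unfold_locales (use fin sym in \<open>auto simp: torus2_def\<close>)
qed

definition balanced_colouring :: "'a pair_pre_digraph \<Rightarrow> 'a set \<Rightarrow> 'a set \<Rightarrow> bool" where
  "balanced_colouring G R B \<longleftrightarrow> R \<union> B = pverts G \<and> R \<inter> B = {} \<and> card R = card B"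

text \<open>Since \<^const>\<open>pmf_of_set\<close> is unspecified on the empty set, a step is only meaningful
  from a vertex with a neighbour. For \<^const>\<open>torus2\<close> the only exception is \<open>k = 1\<close>,
  where no balanced colouring exists.\<close>

definition srw_step :: "'a pair_pre_digraph \<Rightarrow> 'a \<Rightarrow> 'a pmf" where
  "srw_step G v = pmf_of_set {w. (v, w) \<in> parcs G}"

definition P2 :: "'a pair_pre_digraph \<Rightarrow> 'a set \<Rightarrow> real" where
  "P2 G S = measure_pmf.prob
     (bind_pmf (pmf_of_set S) (\<lambda>X0.
      bind_pmf (srw_step G X0) (\<lambda>X1.
      bind_pmf (srw_step G X1) (\<lambda>X2. return_pmf (X1, X2)))))
     {(X1, X2). X1 \<in> S \<and> X2 \<in> S}"

text \<open>Graph sequences are indexed from 1; the value at index 0 is ignored.\<close>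

definition P_limit :: "(nat \<Rightarrow> 'a pair_pre_digraph) \<Rightarrow> (real \<times> real) set" where
  "P_limit G = {(x, y). \<forall>\<epsilon>>0. \<exists>k\<ge>1. \<exists>R B. balanced_colouring (G k) R B \<and>
     \<bar>P2 (G k) R - x\<bar> < \<epsilon> \<and> \<bar>P2 (G k) B - y\<bar> < \<epsilon>}"

end

(* Both coordinates are averages of (d/4)^2, where d is the number of neighbours of a vertex in its
   own class: walk one step forwards and one step backwards from the middle vertex. Balancedness and
   double counting of the bichromatic edges give e = \<Sum>_R d = \<Sum>_B d. From d^2 \<le> 4d on R and the
   chords d^2 \<ge> 5d - 6, d^2 \<ge> 7d - 12 on B one gets two of the three edges of the hull below the
   diagonal. The edge through (0,0) and (1/2,1/4), that is \<Sum>_R d^2 \<le> 2 \<Sum>_B d^2, is not a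
   consequence of degree counting and is proved by discharging on the square grid.
   Conversely, horizontal strips that are monochromatic or carry a periodic pattern (chessboard,
   every third diagonal, perfect code modulo 5) realise the hull_vertices; since each row of a strip has
   an exact colour density, integer strip heights give exactly balanced colourings, and only the
   boundedly many rows at strip boundaries cause an error, which is of order 1/k. *)

theory Submission
  imports Defs
begin

subsection \<open>Sums over a period of the grid\<close>

definition nb :: "(int \<Rightarrow> int \<Rightarrow> real) \<Rightarrow> int \<Rightarrow> int \<Rightarrow> real" where
  "nb F x y = F (x + 1) y + F (x - 1) y + F x (y + 1) + F x (y - 1)"

definition ind :: "(int \<Rightarrow> int \<Rightarrow> bool) \<Rightarrow> int \<Rightarrow> int \<Rightarrow> real" where
  "ind c x y = of_bool (c x y)"

definition opposite :: "(int \<Rightarrow> int \<Rightarrow> bool) \<Rightarrow> int \<Rightarrow> int \<Rightarrow> bool" where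
  "opposite c x y \<longleftrightarrow> \<not> c x y"

definition periodic :: "int \<Rightarrow> (int \<Rightarrow> int \<Rightarrow> 'a) \<Rightarrow> bool" where
  "periodic K F \<longleftrightarrow> (\<forall>x y. F (x + K) y = F x y \<and> F x (y + K) = F x y)"

definition box_sum :: "int \<Rightarrow> (int \<Rightarrow> int \<Rightarrow> real) \<Rightarrow> real" where
  "box_sum K F = (\<Sum>x\<in>{1..K}. \<Sum>y\<in>{1..K}. F x y)"

lemma sum_shift_one:
  fixes f :: "int \<Rightarrow> 'a::comm_monoid_add"
  assumes "K \<ge> 1" "\<And>x. f (x + K) = f x"
  shows "(\<Sum>x\<in>{1..K}. f (x + 1)) = (\<Sum>x\<in>{1..K}. f x)"
proof -
  have "(\<Sum>x\<in>{1..K}. f (x + 1)) = (\<Sum>x\<in>{2..K+1}. f x)"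
    by (rule sum.reindex_bij_witness[of _ "\<lambda>x. x - 1" "\<lambda>x. x + 1"]) auto
  also have "{2..K+1} = insert (K+1) {2..K}"
    using assms(1) by auto
  also have "(\<Sum>x\<in>insert (K+1) {2..K}. f x) = f (1 + K) + (\<Sum>x\<in>{2..K}. f x)"
    by (simp add: add.commute)
  also have "\<dots> = (\<Sum>x\<in>insert 1 {2..K}. f x)"
    using assms(2) by simp
  also have "insert 1 {2..K} = {1..K}"
    using assms(1) by auto
  finally show ?thesis .
qed

lemma sum_shift:
  fixes f :: "int \<Rightarrow> 'a::comm_monoid_add"
  assumes "K \<ge> 1" "\<And>x. f (x + K) = f x"
  shows "(\<Sum>x\<in>{1..K}. f (x + s)) = (\<Sum>x\<in>{1..K}. f x)"
proof (induction s rule: int_induct[where k = 0])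
  case (step1 i)
  have "f (x + i + K) = f (x + i)" for x
    using assms(2)[of "x + i"] by simp
  with sum_shift_one[OF assms(1), of "\<lambda>x. f (x + i)"] step1 show ?case
    by (simp add: ac_simps)
next
  case (step2 i)
  have "f (x + (i - 1) + K) = f (x + (i - 1))" for x
    using assms(2)[of "x + (i - 1)"] by simp
  with sum_shift_one[OF assms(1), of "\<lambda>x. f (x + (i - 1))"] step2 show ?case
    by (simp add: ac_simps)
qed auto

lemma sum_blocks:
  fixes f :: "int \<Rightarrow> real"
  assumes "p \<ge> 1" "\<And>x. f (x + p) = f x"
  shows "(\<Sum>x\<in>{1..p * int q}. f x) = real q * (\<Sum>x\<in>{1..p}. f x)"
proof (induction q)
  case (Suc q)
  have per: "f (x + p * int j) = f x" for x j
  proof (induction j)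
    case (Suc j)
    then show ?case using assms(2)[of "x + p * int j"] by (simp add: algebra_simps)
  qed simp
  obtain m where m: "m = p * int q" "0 \<le> m"
    using assms(1) by simp
  then have "{1..p * int (Suc q)} = {1..p * int q} \<union> {p * int q + 1..p * int q + p}"
    using assms(1) by (auto simp: distrib_left simp flip: m(1))
  moreover have "(\<Sum>x\<in>{p * int q + 1..p * int q + p}. f x) = (\<Sum>x\<in>{1..p}. f (x + p * int q))"
    by (rule sum.reindex_bij_witness[of _ "\<lambda>x. x + p * int q" "\<lambda>x. x - p * int q"]) auto
  moreover have "{1..p * int q} \<inter> {p * int q + 1..p * int q + p} = {}" by auto
  ultimately show ?case
    by (simp add: sum.union_disjoint Suc.IH per algebra_simps)
qed simp

lemma box_sum_cong:
  assumes "\<And>x y. F x y = G x y" shows "box_sum K F = box_sum K G"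
  using assms by (simp add: box_sum_def)

lemma box_sum_add: "box_sum K (\<lambda>x y. F x y + G x y) = box_sum K F + box_sum K G"
  by (simp add: box_sum_def sum.distrib)

lemma box_sum_diff: "box_sum K (\<lambda>x y. F x y - G x y) = box_sum K F - box_sum K G"
  by (simp add: box_sum_def sum_subtractf)

lemma box_sum_cmult: "box_sum K (\<lambda>x y. a * F x y) = a * box_sum K F"
  by (simp add: box_sum_def sum_distrib_left)

lemma box_sum_mono:
  assumes "\<And>x y. F x y \<le> G x y" shows "box_sum K F \<le> box_sum K G"
  using assms by (auto simp: box_sum_def intro!: sum_mono)

lemma box_sum_shift_x:
  assumes "K \<ge> 1" "periodic K F"
  shows "box_sum K (\<lambda>x y. F (x + s) y) = box_sum K F"
  unfolding box_sum_def using assms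
  by (intro sum_shift[where f = "\<lambda>x. \<Sum>y\<in>{1..K}. F x y"]) (auto simp: periodic_def)

lemma box_sum_shift_y:
  assumes "K \<ge> 1" "periodic K F"
  shows "box_sum K (\<lambda>x y. F x (y + s)) = box_sum K F"
  unfolding box_sum_def using assms
  by (intro sum.cong refl sum_shift) (auto simp: periodic_def)

lemma box_sum_nb_adjoint:
  assumes "K \<ge> 1" and F: "periodic K F" and G: "periodic K G"
  shows "box_sum K (\<lambda>x y. F x y * nb G x y) = box_sum K (\<lambda>x y. nb F x y * G x y)"
proof -
  have per: "periodic K (\<lambda>x y. F (x + a) (y + b) * G (x + a') (y + b'))" for a b a' b'
    using F G by (auto simp: periodic_def add.assoc add.commute[of K] simp flip: add.assoc)
      (metis add.assoc add.commute)+
  have "box_sum K (\<lambda>x y. F x y * G (x + s) y) = box_sum K (\<lambda>x y. F (x - s) y * G x y)" for s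
    using box_sum_shift_x[OF assms(1) per[of "-s" 0 0 0], of s] by simp
  moreover have "box_sum K (\<lambda>x y. F x y * G x (y + s)) = box_sum K (\<lambda>x y. F x (y - s) * G x y)" for s
    using box_sum_shift_y[OF assms(1) per[of 0 "-s" 0 0], of s] by simp
  note this[of 1] this[of "-1"] calculation[of 1] calculation[of "-1"]
  ultimately show ?thesis
    by (simp add: nb_def algebra_simps box_sum_add)
qed

text \<open>The lower bound on the second coordinate near the origin is a discharging argument. Vertices
  with \<open>c x y\<close> are called red, the others blue: a blue
  vertex with exactly one blue neighbour claims up to two units from that neighbour, and is paid
  one unit by each red neighbour that itself has a red neighbour.\<close>

definition mixed :: "(int \<Rightarrow> int \<Rightarrow> bool) \<Rightarrow> int \<Rightarrow> int \<Rightarrow> bool" where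
  "mixed c x y \<longleftrightarrow> c x y \<and> (c (x + 1) y \<or> c (x - 1) y \<or> c x (y + 1) \<or> c x (y - 1))"

definition claim :: "(int \<Rightarrow> int \<Rightarrow> bool) \<Rightarrow> int \<Rightarrow> int \<Rightarrow> real" where
  "claim c x y = (if \<not> c x y \<and> nb (ind (opposite c)) x y = 1
     then max 0 (2 - nb (ind (mixed c)) x y) else 0)"

lemma claim_nonneg: "claim c x y \<ge> 0"
  by (simp add: claim_def)

lemma ind_nonneg: "ind c x y \<ge> 0"
  by (simp add: ind_def)

lemma nb_nonneg: "(\<And>x y. F x y \<ge> 0) \<Longrightarrow> nb F x y \<ge> 0"
  by (simp add: nb_def)

lemma claim_le_2: "claim c x y \<le> 2"
  using nb_nonneg[of "ind (mixed c)" x y] by (simp add: claim_def ind_nonneg)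

lemma claim_red: "c x y \<Longrightarrow> claim c x y = 0"
  by (simp add: claim_def)

lemma claim_le:
  assumes "\<not> c x y"
  shows "\<not> c (x + 1) y \<Longrightarrow> claim c (x + 1) y \<le> of_bool (\<not> c x (y + 1)) + of_bool (\<not> c x (y - 1))"
    and "\<not> c (x - 1) y \<Longrightarrow> claim c (x - 1) y \<le> of_bool (\<not> c x (y + 1)) + of_bool (\<not> c x (y - 1))"
    and "\<not> c x (y + 1) \<Longrightarrow> claim c x (y + 1) \<le> of_bool (\<not> c (x + 1) y) + of_bool (\<not> c (x - 1) y)"
    and "\<not> c x (y - 1) \<Longrightarrow> claim c x (y - 1) \<le> of_bool (\<not> c (x + 1) y) + of_bool (\<not> c (x - 1) y)"
  using assms
  by (auto simp: claim_def nb_def ind_def opposite_def mixed_def of_bool_def split: if_splits)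

lemma claim_le_mixed:
  assumes "\<not> c x y"
  shows "\<not> c (x + 1) y \<Longrightarrow> c x (y + 1) \<Longrightarrow> claim c (x + 1) y \<le> ind (mixed c) x (y + 1)"
    and "\<not> c (x + 1) y \<Longrightarrow> c x (y - 1) \<Longrightarrow> claim c (x + 1) y \<le> ind (mixed c) x (y - 1)"
    and "\<not> c (x - 1) y \<Longrightarrow> c x (y + 1) \<Longrightarrow> claim c (x - 1) y \<le> ind (mixed c) x (y + 1)"
    and "\<not> c (x - 1) y \<Longrightarrow> c x (y - 1) \<Longrightarrow> claim c (x - 1) y \<le> ind (mixed c) x (y - 1)"
    and "\<not> c x (y + 1) \<Longrightarrow> c (x + 1) y \<Longrightarrow> claim c x (y + 1) \<le> ind (mixed c) (x + 1) y"
    and "\<not> c x (y + 1) \<Longrightarrow> c (x - 1) y \<Longrightarrow> claim c x (y + 1) \<le> ind (mixed c) (x - 1) y"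
    and "\<not> c x (y - 1) \<Longrightarrow> c (x + 1) y \<Longrightarrow> claim c x (y - 1) \<le> ind (mixed c) (x + 1) y"
    and "\<not> c x (y - 1) \<Longrightarrow> c (x - 1) y \<Longrightarrow> claim c x (y - 1) \<le> ind (mixed c) (x - 1) y"
  using assms
  by (auto simp: claim_def nb_def ind_def opposite_def mixed_def of_bool_def split: if_splits)

lemma nb_claim_le:
  assumes "\<not> c x y"
  defines "d \<equiv> nb (ind (opposite c)) x y"
  shows "nb (claim c) x y \<le> nb (ind (mixed c)) x y + 2 * (d\<^sup>2 - 2 * d) + claim c x y"
proof -
  let ?f = "nb (ind (mixed c)) x y"
  note ge0 = ind_nonneg[of "mixed c" "x+1" y] ind_nonneg[of "mixed c" "x-1" y]
     ind_nonneg[of "mixed c" x "y+1"] ind_nonneg[of "mixed c" x "y-1"]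
  note le2 = claim_le_2[of c "x+1" y] claim_le_2[of c "x-1" y] claim_le_2[of c x "y+1"]
     claim_le_2[of c x "y-1"]
  have "d = 1 \<Longrightarrow> claim c x y \<ge> 2 - ?f"
    using assms by (simp add: claim_def)
  then show ?thesis
    using assms(1) claim_le[of c x y] claim_le_mixed[of c x y] ge0 le2 claim_nonneg[of c x y]
    unfolding d_def nb_def
    by (cases "c (x+1) y"; cases "c (x-1) y"; cases "c x (y+1)"; cases "c x (y-1)")
       (simp_all add: ind_def[of "opposite c"] opposite_def claim_red)
qed

lemma periodic_ind: "periodic K c \<Longrightarrow> periodic K (ind c)"
  by (simp add: periodic_def ind_def)

lemma periodic_opposite: "periodic K c \<Longrightarrow> periodic K (opposite c)"
  by (simp add: periodic_def opposite_def)

lemma periodic_shift: "periodic K F \<Longrightarrow> periodic K (\<lambda>x y. F (x + a) (y + b))"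
  unfolding periodic_def by (metis add.assoc add.commute)

lemma periodic_nb:
  assumes "periodic K F" shows "periodic K (nb F)"
  using periodic_shift[OF assms, of 1 0] periodic_shift[OF assms, of "-1" 0]
    periodic_shift[OF assms, of 0 1] periodic_shift[OF assms, of 0 "-1"]
  by (simp add: periodic_def nb_def)

lemma periodic_mixed:
  assumes "periodic K c" shows "periodic K (mixed c)"
  using assms periodic_shift[OF assms, of 1 0] periodic_shift[OF assms, of "-1" 0]
    periodic_shift[OF assms, of 0 1] periodic_shift[OF assms, of 0 "-1"]
  by (simp add: periodic_def mixed_def)

lemma periodic_claim:
  assumes "periodic K c" shows "periodic K (claim c)"
  using assms periodic_nb[OF periodic_ind[OF periodic_opposite[OF assms]]]
    periodic_nb[OF periodic_ind[OF periodic_mixed[OF assms]]]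
  by (simp add: periodic_def claim_def)

lemma ind_opposite: "ind (opposite c) x y = 1 - ind c x y"
  by (simp add: ind_def opposite_def)

lemma nb_ind_opposite: "nb (ind (opposite c)) x y = 4 - nb (ind c) x y"
  by (simp add: nb_def ind_opposite)

definition num_cells :: "int \<Rightarrow> (int \<Rightarrow> int \<Rightarrow> bool) \<Rightarrow> real" where
  "num_cells K c = box_sum K (ind c)"

definition deg_sum :: "int \<Rightarrow> (int \<Rightarrow> int \<Rightarrow> bool) \<Rightarrow> real" where
  "deg_sum K c = box_sum K (\<lambda>x y. ind c x y * nb (ind c) x y)"

definition deg2_sum :: "int \<Rightarrow> (int \<Rightarrow> int \<Rightarrow> bool) \<Rightarrow> real" where
  "deg2_sum K c = box_sum K (\<lambda>x y. ind c x y * (nb (ind c) x y)\<^sup>2)"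

lemma deg_sum_opposite:
  assumes "K \<ge> 1" "periodic K c" "num_cells K c = num_cells K (opposite c)"
  shows "deg_sum K (opposite c) = deg_sum K c"
proof -
  note p = periodic_ind[OF assms(2)] periodic_ind[OF periodic_opposite[OF assms(2)]]
  have "4 * num_cells K c - deg_sum K c = box_sum K (\<lambda>x y. ind c x y * nb (ind (opposite c)) x y)"
    by (simp add: num_cells_def deg_sum_def nb_ind_opposite algebra_simps box_sum_diff flip: box_sum_cmult)
  also have "\<dots> = box_sum K (\<lambda>x y. nb (ind c) x y * ind (opposite c) x y)"
    by (rule box_sum_nb_adjoint[OF assms(1) p])
  also have "\<dots> = 4 * num_cells K (opposite c) - deg_sum K (opposite c)"
    by (simp add: num_cells_def deg_sum_def nb_ind_opposite[of c] algebra_simps box_sum_diff flip: box_sum_cmult)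
  finally show ?thesis using assms(3) by simp
qed

lemma nb_ind_cases: "nb (ind c) x y \<in> {0, 1, 2, 3, 4}"
  by (simp add: nb_def ind_def)

lemma deg2_sum_le: "deg2_sum K c \<le> 4 * deg_sum K c"
proof -
  have "ind c x y * (nb (ind c) x y)\<^sup>2 \<le> 4 * (ind c x y * nb (ind c) x y)" for x y
    using nb_ind_cases[of c x y] by (auto simp: ind_def)
  then show ?thesis
    unfolding deg2_sum_def deg_sum_def by (subst box_sum_cmult[symmetric]) (rule box_sum_mono)
qed

lemma deg2_sum_ge:
  assumes "\<And>i::real. i \<in> {0, 1, 2, 3, 4} \<Longrightarrow> a * i - b \<le> i\<^sup>2"
  shows "a * deg_sum K c - b * num_cells K c \<le> deg2_sum K c"
proof -
  have "a * deg_sum K c - b * num_cells K c = box_sum K (\<lambda>x y. ind c x y * (a * nb (ind c) x y - b))"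
    unfolding deg_sum_def num_cells_def 
    by (simp add: algebra_simps box_sum_diff flip: box_sum_cmult)
  also have "\<dots> \<le> deg2_sum K c"
    unfolding deg2_sum_def using assms[OF nb_ind_cases]
    by (intro box_sum_mono mult_left_mono) (auto simp: ind_def)
  finally show ?thesis .
qed

lemma deg2_sum_le_double_opposite:
  assumes "K \<ge> 1" "periodic K c" "num_cells K c = num_cells K (opposite c)"
  shows "deg2_sum K c \<le> 2 * deg2_sum K (opposite c)"
proof -
  let ?R = "ind c" and ?B = "ind (opposite c)" and ?M = "ind (mixed c)"
  let ?f = "nb ?M" and ?d = "nb ?B"
  note p = periodic_ind[OF assms(2)] periodic_ind[OF periodic_opposite[OF assms(2)]]
    periodic_ind[OF periodic_mixed[OF assms(2)]] periodic_claim[OF assms(2)]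
  have "box_sum K (\<lambda>x y. claim c x y) = box_sum K (\<lambda>x y. claim c x y * ?d x y)"
    by (rule box_sum_cong) (simp add: claim_def)
  also have "\<dots> = box_sum K (\<lambda>x y. nb (claim c) x y * ?B x y)"
    by (rule box_sum_nb_adjoint[OF assms(1) p(4,2)])
  also have "\<dots> \<le> box_sum K (\<lambda>x y. ?B x y * ?f x y + (2 * (?B x y * (?d x y)\<^sup>2)
       - 4 * (?B x y * ?d x y)) + claim c x y)"
  proof (rule box_sum_mono)
    show "nb (claim c) x y * ?B x y \<le> ?B x y * ?f x y + (2 * (?B x y * (?d x y)\<^sup>2)
       - 4 * (?B x y * ?d x y)) + claim c x y" for x y
      using nb_claim_le[of c x y] claim_nonneg[of c x y] 
      by (cases "c x y") (simp_all add: ind_def[of "opposite c"] opposite_def)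
  qed
  also have "\<dots> = box_sum K (\<lambda>x y. ?B x y * ?f x y) + (2 * deg2_sum K (opposite c) - 4 * deg_sum K (opposite c))
      + box_sum K (\<lambda>x y. claim c x y)"
    by (simp add: box_sum_add box_sum_diff box_sum_cmult deg2_sum_def deg_sum_def)
  also have "box_sum K (\<lambda>x y. ?B x y * ?f x y) = box_sum K (\<lambda>x y. ?d x y * ?M x y)"
    by (rule box_sum_nb_adjoint[OF assms(1) p(2,3)])
  also have "\<dots> \<le> box_sum K (\<lambda>x y. 4 * (?R x y * nb ?R x y) - ?R x y * (nb ?R x y)\<^sup>2)"
  proof (rule box_sum_mono)
    show "?d x y * ?M x y \<le> 4 * (?R x y * nb ?R x y) - ?R x y * (nb ?R x y)\<^sup>2" for x y
      by (auto simp: nb_def ind_def mixed_def opposite_def)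
  qed
  also have "\<dots> = 4 * deg_sum K c - deg2_sum K c"
    by (simp add: box_sum_diff box_sum_cmult deg2_sum_def deg_sum_def)
  finally show ?thesis
    using deg_sum_opposite[OF assms] by simp
qed

subsection \<open>The two-step return probability\<close>

definition wrap :: "int \<Rightarrow> int \<Rightarrow> int" where
  "wrap K z = (z - 1) mod K + 1"

lemma wrap_in: "K \<ge> 1 \<Longrightarrow> wrap K z \<in> {1..K}"
  using pos_mod_bound[of K "z - 1"] pos_mod_sign[of K "z - 1"] unfolding wrap_def
  by (simp del: pos_mod_bound)

lemma wrap_id: "z \<in> {1..K} \<Longrightarrow> wrap K z = z"
  by (simp add: wrap_def)

lemma wrap_add: "wrap K (z + K) = wrap K z"
  by (simp add: wrap_def diff_add_eq[symmetric])

lemma cong_iff_wrap: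
  assumes "x \<in> {1..K}"
  shows "[z = x] (mod K) \<longleftrightarrow> x = wrap K z"
proof -
  have "[z = x] (mod K) \<longleftrightarrow> [z - 1 = x - 1] (mod K)"
    by (simp add: cong_iff_dvd_diff)
  also have "\<dots> \<longleftrightarrow> (z - 1) mod K = x - 1"
    using assms mod_pos_pos_trivial[of "x - 1" K] by (simp add: cong_def)
  finally show ?thesis by (auto simp: wrap_def)
qed

lemma wrap_eqD:
  assumes "K \<ge> 1" "wrap K a = wrap K b"
  shows "K dvd a - b"
  using assms by (simp add: wrap_def mod_eq_dvd_iff)

lemma torus2_neighbours:
  assumes "k \<ge> 2" "x \<in> {1..int k}" "y \<in> {1..int k}"
  shows "{w. ((x, y), w) \<in> parcs (torus2 k)} =
    {(wrap (int k) (x + 1), y), (wrap (int k) (x - 1), y), (x, wrap (int k) (y + 1)), (x, wrap (int k) (y - 1))}"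
proof -
  let ?K = "int k"
  have step: "a \<noteq> b \<and> ([a = b + 1] (mod ?K) \<or> [a = b - 1] (mod ?K)) \<longleftrightarrow>
      b = wrap ?K (a + 1) \<or> b = wrap ?K (a - 1)"
    if "a \<in> {1..?K}" "b \<in> {1..?K}" for a b
  proof -
    have "wrap ?K (a + 1) \<noteq> a" "wrap ?K (a - 1) \<noteq> a"
      using wrap_eqD[of ?K "a + 1" a] wrap_eqD[of ?K "a - 1" a] wrap_id[OF that(1)] assms(1)
      by auto
    moreover have "[a = b + 1] (mod ?K) \<longleftrightarrow> b = wrap ?K (a - 1)"
        "[a = b - 1] (mod ?K) \<longleftrightarrow> b = wrap ?K (a + 1)"
      by (subst cong_iff_wrap[OF that(2), symmetric], simp add: cong_iff_dvd_diff algebra_simps)+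
    ultimately show ?thesis by auto
  qed
  have "wrap ?K z \<in> {1..?K}" for z
    using assms(1) by (intro wrap_in) simp
  then have "((x, y), (a, b)) \<in> parcs (torus2 k) \<longleftrightarrow>
      b = y \<and> (a = wrap ?K (x + 1) \<or> a = wrap ?K (x - 1)) \<or>
      a = x \<and> (b = wrap ?K (y + 1) \<or> b = wrap ?K (y - 1))" for a b
    using assms(2,3) step[OF assms(2), of a] step[OF assms(3), of b]
    unfolding torus2_def by simp metis
  then show ?thesis
    by auto
qed

text \<open>This also holds for \<open>k = 2\<close>, where the four shifts visit each of the two neighbours twice.\<close>

lemma expectation_srw_step:
  assumes "k \<ge> 2" "x \<in> {1..int k}" "y \<in> {1..int k}"
  shows "measure_pmf.expectation (srw_step (torus2 k) (x, y)) g =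
    (g (wrap (int k) (x + 1), y) + g (wrap (int k) (x - 1), y) +
     g (x, wrap (int k) (y + 1)) + g (x, wrap (int k) (y - 1))) / (4::real)"
proof -
  let ?K = "int k"
  let ?N = "{(wrap ?K (x + 1), y), (wrap ?K (x - 1), y), (x, wrap ?K (y + 1)), (x, wrap ?K (y - 1))}"
  have E: "measure_pmf.expectation (srw_step (torus2 k) (x, y)) g = sum g ?N / card ?N"
    unfolding srw_step_def torus2_neighbours[OF assms] by (rule integral_pmf_of_set) auto
  have ne: "wrap ?K (z + 1) \<noteq> z" "wrap ?K (z - 1) \<noteq> z" if "z \<in> {1..?K}" for z
    using wrap_eqD[of ?K "z + 1" z] wrap_eqD[of ?K "z - 1" z] wrap_id[OF that] assms(1) by auto
  note ne = ne[OF assms(2)] ne[OF assms(3)]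
  note ne = ne ne[symmetric]
  show ?thesis
  proof (cases "k = 2")
    case True
    have "wrap ?K (z + 1) = wrap ?K (z - 1)" for z
      using wrap_add[of ?K "z - 1"] True by (simp add: add.commute)
    then show ?thesis using E ne by simp
  next
    case False
    have "wrap ?K (z + 1) \<noteq> wrap ?K (z - 1)" for z
      using wrap_eqD[of ?K "z + 1" "z - 1"] zdvd_imp_le[of ?K 2] assms(1) False by auto
    note ne = ne this this[symmetric]
    show ?thesis using E ne by simp
  qed
qed


lemma periodic_wrap:
  assumes "periodic K F"
  shows "F (wrap K x) y = F x y" "F x (wrap K y) = F x y"
proof -
  have "F (x + K * j) y = F x y \<and> F x (y + K * j) = F x y" for x y j
  proof (induction j rule: int_induct[where k = 0])
    case (step1 i)
    then show ?case
      using assms unfolding periodic_def by (metis add.assoc distrib_left mult.right_neutral)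
  next
    case (step2 i)
    have "x + K * (i - 1) + K = x + K * i" "y + K * (i - 1) + K = y + K * i"
      by (simp_all add: algebra_simps)
    with step2 show ?case
      using assms unfolding periodic_def by metis
  qed auto
  moreover have "wrap K z = z + K * (- ((z - 1) div K))" for z
    by (simp add: wrap_def minus_mult_div_eq_mod[symmetric])
  ultimately show "F (wrap K x) y = F x y" "F x (wrap K y) = F x y"
    by metis+
qed

lemma expectation_bind_pmf:
  fixes h :: "'b \<Rightarrow> real"
  assumes "finite (set_pmf p)" "\<And>x. x \<in> set_pmf p \<Longrightarrow> finite (set_pmf (f x))"
  shows "measure_pmf.expectation (bind_pmf p f) h =
    measure_pmf.expectation p (\<lambda>x. measure_pmf.expectation (f x) h)"
  using assms by (simp add: pmf_expectation_bind[where A = "set_pmf p"] integral_measure_pmf[where A = "set_pmf p"])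

lemma set_srw_step:
  assumes "k \<ge> 2" "v \<in> pverts (torus2 k)"
  shows "set_pmf (srw_step (torus2 k) v) \<subseteq> pverts (torus2 k)" "finite (set_pmf (srw_step (torus2 k) v))"
proof -
  obtain x y where v: "v = (x, y)" "x \<in> {1..int k}" "y \<in> {1..int k}"
    using assms(2) by (auto simp: torus2_def)
  have "set_pmf (srw_step (torus2 k) v) = {w. ((x, y), w) \<in> parcs (torus2 k)}"
    unfolding srw_step_def v(1)
    by (subst set_pmf_of_set) (auto simp: torus2_neighbours[OF assms(1) v(2,3)])
  then show "set_pmf (srw_step (torus2 k) v) \<subseteq> pverts (torus2 k)" "finite (set_pmf (srw_step (torus2 k) v))"
    using wrap_in[of "int k"] assms(1) v(2,3)
    by (auto simp: torus2_neighbours[OF assms(1) v(2,3)]) (simp_all add: torus2_def)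
qed

definition periodic_extension :: "int \<Rightarrow> (int \<times> int) set \<Rightarrow> int \<Rightarrow> int \<Rightarrow> bool" where
  "periodic_extension K S x y \<longleftrightarrow> (wrap K x, wrap K y) \<in> S"

lemma periodic_extension_periodic: "periodic K (periodic_extension K S)"
  by (simp add: periodic_def periodic_extension_def wrap_add)

lemma sum_eq_box_sum:
  assumes "S \<subseteq> {1..K} \<times> {1..K}"
  shows "(\<Sum>(x, y)\<in>S. F x y) = box_sum K (\<lambda>x y. ind (periodic_extension K S) x y * F x y)"
proof -
  have "(\<Sum>(x, y)\<in>S. F x y) = (\<Sum>(x, y)\<in>{1..K} \<times> {1..K}. ind (periodic_extension K S) x y * F x y)"
    using assms by (intro sum.mono_neutral_cong_left) (auto simp: ind_def periodic_extension_def wrap_id)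
  then show ?thesis
    by (simp add: box_sum_def sum.cartesian_product)
qed

lemma P2_torus2:
  assumes k: "k \<ge> 2" and S: "S \<subseteq> pverts (torus2 k)" "S \<noteq> {}"
  shows "P2 (torus2 k) S = deg2_sum (int k) (periodic_extension (int k) S) / (16 * real (card S))"
proof -
  let ?K = "int k" and ?G = "torus2 k"
  let ?c = "periodic_extension ?K S" and ?A = "indicator {(X1, X2). X1 \<in> S \<and> X2 \<in> S} :: _ \<Rightarrow> real"
  let ?E = "\<lambda>v f. measure_pmf.expectation (srw_step ?G v) f :: real"
  have V: "pverts ?G = {1..?K} \<times> {1..?K}"
    by (simp add: torus2_def)
  then have fin: "finite S"
    using S finite_subset by fastforce
  define F where "F = (\<lambda>x y. ind ?c x y * nb (ind ?c) x y)"
  have per: "periodic ?K (ind ?c)" "periodic ?K F"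
    using periodic_ind[OF periodic_extension_periodic] periodic_nb[OF periodic_ind[OF periodic_extension_periodic]]
    by (auto simp: periodic_def F_def)
  have ind_S: "of_bool (v \<in> S) = ind ?c (fst v) (snd v)" if "v \<in> pverts ?G" for v
    using that by (auto simp: ind_def periodic_extension_def wrap_id V)
  have E: "?E (x, y) (\<lambda>v. H (fst v) (snd v)) = nb H x y / 4" 
    if "x \<in> {1..?K}" "y \<in> {1..?K}" "periodic ?K H" for x y H
    by (simp add: expectation_srw_step[OF k that(1,2)] nb_def periodic_wrap[OF that(3)])
  have E_cong: "?E v f = ?E v g" if "v \<in> pverts ?G" "\<And>w. w \<in> pverts ?G \<Longrightarrow> f w = g w" for v and f g :: "_ \<Rightarrow> real"
    using set_srw_step(1)[OF k that(1)] that(2) by (intro integral_cong_AE) (auto simp: AE_measure_pmf_iff)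
  have fin1: "finite (set_pmf (bind_pmf (srw_step ?G w) (\<lambda>X2. return_pmf (w, X2))))"
    if "w \<in> pverts ?G" for w
    using set_srw_step[OF k that] by (simp add: set_bind_pmf)
  have fin2: "finite (set_pmf (bind_pmf (srw_step ?G v) (\<lambda>X1. bind_pmf (srw_step ?G X1) (\<lambda>X2. return_pmf (X1, X2)))))"
    if "v \<in> pverts ?G" for v
    unfolding set_bind_pmf[of "srw_step ?G v"] using set_srw_step[OF k that] fin1 by blast
  have two: "measure_pmf.expectation (bind_pmf (srw_step ?G v) (\<lambda>X1. bind_pmf (srw_step ?G X1) (\<lambda>X2. return_pmf (X1, X2))))
      ?A = nb F (fst v) (snd v) / 16" if v: "v \<in> pverts ?G" for v
  proof -
    have "measure_pmf.expectation (bind_pmf (srw_step ?G v) (\<lambda>X1. bind_pmf (srw_step ?G X1) (\<lambda>X2. return_pmf (X1, X2))))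
       ?A =
       ?E v (\<lambda>X1. measure_pmf.expectation (bind_pmf (srw_step ?G X1) (\<lambda>X2. return_pmf (X1, X2)))
         ?A)"
      using set_srw_step[OF k v] fin1 by (intro expectation_bind_pmf) blast+
    also have "\<dots> = ?E v (\<lambda>X1. F (fst X1) (snd X1) / 4)"
    proof (rule E_cong[OF v])
      fix w assume w: "w \<in> pverts ?G"
      have "measure_pmf.expectation (bind_pmf (srw_step ?G w) (\<lambda>X2. return_pmf (w, X2)))
         ?A = ?E w (\<lambda>X2. of_bool (w \<in> S) * of_bool (X2 \<in> S))"
        using set_srw_step[OF k w] by (subst expectation_bind_pmf) (auto simp: indicator_def of_bool_def intro!: Bochner_Integration.integral_cong)
      also have "\<dots> = of_bool (w \<in> S) * ?E w (\<lambda>X2. of_bool (X2 \<in> S))"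
        by (rule integral_mult_right_zero)
      also have "?E w (\<lambda>X2. of_bool (X2 \<in> S)) = ?E w (\<lambda>X2. ind ?c (fst X2) (snd X2))"
        by (rule E_cong[OF w ind_S])
      also have "\<dots> = nb (ind ?c) (fst w) (snd w) / 4"
        using E[of "fst w" "snd w", OF _ _ per(1)] w by (auto simp: V)
      finally show "measure_pmf.expectation (bind_pmf (srw_step ?G w) (\<lambda>X2. return_pmf (w, X2)))
         ?A = F (fst w) (snd w) / 4"
        by (simp add: F_def ind_S[OF w])
    qed
    also have "\<dots> = ?E v (\<lambda>X1. F (fst X1) (snd X1)) / 4"
      by simp
    also have "\<dots> = nb F (fst v) (snd v) / 16"
      using E[of "fst v" "snd v", OF _ _ per(2)] v by (auto simp: V)
    finally show ?thesis .
  qed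
  let ?Q = "\<lambda>X0. bind_pmf (srw_step ?G X0) (\<lambda>X1. bind_pmf (srw_step ?G X1) (\<lambda>X2. return_pmf (X1, X2)))"
  have "P2 ?G S = measure_pmf.expectation (bind_pmf (pmf_of_set S) ?Q) ?A"
    by (simp add: P2_def)
  also have "\<dots> = measure_pmf.expectation (pmf_of_set S) (\<lambda>v. measure_pmf.expectation (?Q v) ?A)"
    using fin S(1) fin2 set_pmf_of_set[OF S(2) fin] by (intro expectation_bind_pmf) auto
  also have "\<dots> = (\<Sum>v\<in>S. nb F (fst v) (snd v) / 16) / card S"
    unfolding integral_pmf_of_set[OF S(2) fin] using S(1) two
    by (intro arg_cong2[of _ _ _ _ "(/)"] sum.cong refl) blast
  also have "(\<Sum>v\<in>S. nb F (fst v) (snd v) / 16) = box_sum ?K (\<lambda>x y. ind ?c x y * nb F x y) / 16"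
    using sum_eq_box_sum[OF S(1)[unfolded V], of "nb F"] by (simp add: case_prod_unfold flip: sum_divide_distrib)
  also have "box_sum ?K (\<lambda>x y. ind ?c x y * nb F x y) = deg2_sum ?K ?c"
    unfolding deg2_sum_def using k
    by (subst box_sum_nb_adjoint[OF _ per]) (auto intro!: box_sum_cong simp: F_def power2_eq_square)
  finally show ?thesis by simp
qed

lemma num_cells_lift:
  assumes "S \<subseteq> {1..K} \<times> {1..K}"
  shows "num_cells K (periodic_extension K S) = card S"
  using sum_eq_box_sum[OF assms, of "\<lambda>_ _. 1"] by (simp add: num_cells_def case_prod_unfold)

subsection \<open>The outer bound\<close>

lemma periodic_extension_complement:
  assumes "K \<ge> 1" "R \<union> B = {1..K} \<times> {1..K}" "R \<inter> B = {}"
  shows "periodic_extension K B = opposite (periodic_extension K R)"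
proof -
  have "(wrap K x, wrap K y) \<in> R \<union> B" for x y
    using wrap_in[OF assms(1)] by (simp add: assms(2))
  then show ?thesis
    using assms(3) by (auto simp: fun_eq_iff periodic_extension_def opposite_def)
qed

lemma balanced_colouring_sym:
  "balanced_colouring G R B \<Longrightarrow> balanced_colouring G B R"
  by (auto simp: balanced_colouring_def)

lemma balanced_torus2_card:
  assumes "k \<ge> 1" "balanced_colouring (torus2 k) R B"
  shows "k \<ge> 2" "2 * card R = k\<^sup>2" "2 * card B = k\<^sup>2"
proof -
  have "R \<union> B = {1..int k} \<times> {1..int k}" "R \<inter> B = {}" and eq: "card R = card B"
    using assms(2) by (auto simp: balanced_colouring_def torus2_def)
  then have "finite R" "finite B"
    by (metis finite_Un finite_SigmaI finite_atLeastAtMost_int)+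
  then have "card R + card B = card ({1..int k} \<times> {1..int k})"
    using \<open>R \<union> B = _\<close> \<open>R \<inter> B = {}\<close> card_Un_disjoint by metis
  then show *: "2 * card R = k\<^sup>2" and "2 * card B = k\<^sup>2"
    using eq by (simp_all add: card_cartesian_product power2_eq_square)
  show "k \<ge> 2"
    using * assms(1) by (cases "k = 1") auto
qed

lemma balanced_ineqs:
  assumes "k \<ge> 1" "balanced_colouring (torus2 k) R B"
  defines "x \<equiv> P2 (torus2 k) R" and "y \<equiv> P2 (torus2 k) B"
  shows "x \<le> 2 * y" "10 * x \<le> 8 * y + 3" "7 * x \<le> 4 * y + 3"
proof -
  let ?K = "int k"
  have V: "R \<union> B = {1..?K} \<times> {1..?K}" and RB: "R \<inter> B = {}" and eq: "card R = card B"
    using assms(2) by (auto simp: balanced_colouring_def torus2_def)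
  have k: "k \<ge> 2"
    using balanced_torus2_card[OF assms(1,2)] by simp
  have "card R \<noteq> 0" 
    using balanced_torus2_card[OF assms(1,2)] k by (metis mult_0_right power_eq_0_iff not_numeral_le_zero)
  then have ne: "R \<noteq> {}" "B \<noteq> {}" and n: "real (card R) > 0"
    using eq by auto
  have sub: "R \<subseteq> {1..?K} \<times> {1..?K}" "B \<subseteq> {1..?K} \<times> {1..?K}"
    using V by auto
  define c where "c = periodic_extension ?K R"
  have B: "periodic_extension ?K B = opposite c"
    unfolding c_def using periodic_extension_complement[OF _ V RB] k by simp
  have per: "periodic ?K c" and K: "?K \<ge> 1"
    using periodic_extension_periodic k by (auto simp: c_def)
  have num_cells: "num_cells ?K c = card R" "num_cells ?K (opposite c) = card R"
    using num_cells_lift[OF sub(1)] num_cells_lift[OF sub(2)] eq by (simp_all add: c_def flip: B[unfolded c_def])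
  have x: "x * (16 * card R) = deg2_sum ?K c" and y: "y * (16 * card R) = deg2_sum ?K (opposite c)"
    using P2_torus2[OF k _ ne(1)] P2_torus2[OF k _ ne(2)] sub n eq
    by (simp_all add: x_def y_def B torus2_def flip: c_def)
  have e: "deg_sum ?K (opposite c) = deg_sum ?K c"
    using deg_sum_opposite[OF K per] num_cells by simp
  have "x * (16 * card R) \<le> (2 * y) * (16 * card R)"
    using deg2_sum_le_double_opposite[OF K per] num_cells x y by simp
  then show "x \<le> 2 * y"
    using n by (simp add: mult_le_cancel_right)
  have "(10 * x) * (16 * card R) \<le> (8 * y + 3) * (16 * card R)"
    using deg2_sum_ge[of 5 6 ?K "opposite c"] deg2_sum_le[of ?K c] num_cells x y e by (force simp: algebra_simps)
  then show "10 * x \<le> 8 * y + 3"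
    using n by (simp add: mult_le_cancel_right)
  have "(7 * x) * (16 * card R) \<le> (4 * y + 3) * (16 * card R)"
    using deg2_sum_ge[of 7 12 ?K "opposite c"] deg2_sum_le[of ?K c] num_cells x y e by (force simp: algebra_simps)
  then show "7 * x \<le> 4 * y + 3"
    using n by (simp add: mult_le_cancel_right)
qed

lemma P_limit_sym: "(x, y) \<in> P_limit G \<Longrightarrow> (y, x) \<in> P_limit G"
  unfolding P_limit_def using balanced_colouring_sym by fast

lemma P_limit_ineq:
  assumes "(x, y) \<in> P_limit G" "a \<ge> 0" "b \<ge> 0"
    and *: "\<And>k R B. k \<ge> 1 \<Longrightarrow> balanced_colouring (G k) R B \<Longrightarrow> a * P2 (G k) R \<le> b * P2 (G k) B + d"
  shows "a * x \<le> b * y + d"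
proof (rule field_le_epsilon)
  fix e :: real assume "e > 0"
  define \<delta> where "\<delta> = e / (a + b + 1)"
  have \<delta>: "\<delta> > 0" "e = \<delta> * (a + b + 1)"
    using \<open>e > 0\<close> assms(2,3) by (simp_all add: \<delta>_def add_nonneg_eq_0_iff)
  then obtain k R B where k: "k \<ge> 1" "balanced_colouring (G k) R B"
    and "\<bar>P2 (G k) R - x\<bar> < \<delta>" "\<bar>P2 (G k) B - y\<bar> < \<delta>"
    using assms(1) unfolding P_limit_def by blast
  then have "a * (x - P2 (G k) R) \<le> a * \<delta>" "b * (P2 (G k) B - y) \<le> b * \<delta>"
    using assms(2,3) by (auto intro!: mult_left_mono simp del: mult_le_cancel_left)
  moreover have "a * \<delta> + b * \<delta> \<le> e"
    using \<delta> by (simp add: algebra_simps)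
  ultimately show "a * x \<le> b * y + d + e"
    using *[OF k] by (simp add: algebra_simps)
qed

lemma in_convex_hull_3:
  fixes p :: "'a::real_vector"
  assumes "{a, b, c} \<subseteq> S" "u \<ge> 0" "v \<ge> 0" "u + v \<le> 1" "p = (1 - u - v) *\<^sub>R a + u *\<^sub>R b + v *\<^sub>R c"
  shows "p \<in> convex hull S"
proof -
  have "p \<in> convex hull {a, b, c}"
    unfolding convex_hull_3 using assms(2-5)
    by (intro CollectI exI[of _ "1 - u - v"] exI[of _ u] exI[of _ v]) simp
  then show ?thesis
    using hull_mono[OF assms(1)] by blast
qed

definition hull_vertices :: "(real \<times> real) set" where
  "hull_vertices = {(0, 0), (1/2, 1/4), (3/4, 9/16), (1, 1), (1/4, 1/2), (9/16, 3/4)}"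

lemma in_hull_verticesI:
  assumes "x \<le> 2 * y" "10 * x \<le> 8 * y + 3" "7 * x \<le> 4 * y + 3"
    and "y \<le> 2 * x" "10 * y \<le> 8 * x + 3" "7 * y \<le> 4 * x + 3"
  shows "(x, y) \<in> convex hull hull_vertices"
proof -
  consider "y \<le> x" "3 * x \<le> 2 * y + 1" | "y \<le> x" "3 * x \<ge> 2 * y + 1"
    | "x \<le> y" "3 * y \<le> 2 * x + 1" | "x \<le> y" "3 * y \<ge> 2 * x + 1"
    by linarith
  then show ?thesis
  proof cases
    case 1
    then show ?thesis using assms
      by (intro in_convex_hull_3[of "(0, 0)" "(1/2, 1/4)" "(1, 1)" _ "4 * (x - y)" "2 * y - x"])
         (auto simp: hull_vertices_def field_simps)
  next
    case 2
    then show ?thesis using assms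
      by (intro in_convex_hull_3[of "(1, 1)" "(1/2, 1/4)" "(3/4, 9/16)" _
            "14 * (1 - x) - 8 * (1 - y)" "16 * (1 - y) - 24 * (1 - x)"])
         (auto simp: hull_vertices_def algebra_simps)
  next
    case 3
    then show ?thesis using assms
      by (intro in_convex_hull_3[of "(0, 0)" "(1/4, 1/2)" "(1, 1)" _ "4 * (y - x)" "2 * x - y"])
         (auto simp: hull_vertices_def field_simps)
  next
    case 4
    then show ?thesis using assms
      by (intro in_convex_hull_3[of "(1, 1)" "(1/4, 1/2)" "(9/16, 3/4)" _
            "14 * (1 - y) - 8 * (1 - x)" "16 * (1 - x) - 24 * (1 - y)"])
         (auto simp: hull_vertices_def algebra_simps)
  qed
qed

lemma P_limit_torus2_subset: "P_limit torus2 \<subseteq> convex hull hull_vertices"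
proof
  fix p assume "p \<in> P_limit torus2"
  then obtain x y where p: "p = (x, y)" and xy: "(x, y) \<in> P_limit torus2"
    by (cases p) auto
  have ineqs: "x \<le> 2 * y" "10 * x \<le> 8 * y + 3" "7 * x \<le> 4 * y + 3"
    if "(x, y) \<in> P_limit torus2" for x y
    using P_limit_ineq[OF that, of 1 2 0] P_limit_ineq[OF that, of 10 8 3]
      P_limit_ineq[OF that, of 7 4 3] balanced_ineqs by simp_all
  show "p \<in> convex hull hull_vertices"
    unfolding p using ineqs[OF xy] ineqs[OF P_limit_sym[OF xy]] by (intro in_hull_verticesI) auto
qed

subsection \<open>Striped colourings\<close>

type_synonym pattern = "int \<times> int set"

definition row_of :: "pattern list \<Rightarrow> int \<Rightarrow> pattern" where
  "row_of L y = L ! nat ((y - 1) mod int (length L))"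

definition paint :: "pattern list \<Rightarrow> int \<Rightarrow> int \<Rightarrow> bool" where
  "paint L x y \<longleftrightarrow> x + fst (row_of L y) * y \<in> snd (row_of L y)"

text \<open>30 is the least common multiple of the periods 2, 3, 5 of the patterns used below.\<close>

definition mod30 :: "pattern \<Rightarrow> bool" where
  "mod30 t \<longleftrightarrow> (\<forall>r. r + 30 \<in> snd t \<longleftrightarrow> r \<in> snd t)"

definition swap_colours :: "pattern \<Rightarrow> pattern" where
  "swap_colours t = (fst t, - snd t)"

definition dens :: "pattern \<Rightarrow> real" where
  "dens t = (\<Sum>r\<in>{1..30}. of_bool (r \<in> snd t))"

definition dens2 :: "pattern \<Rightarrow> real" where
  "dens2 t = (\<Sum>r\<in>{1..30}. of_bool (r \<in> snd t) *
     (of_bool (r + 1 \<in> snd t) + of_bool (r - 1 \<in> snd t) +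
      of_bool (r + fst t \<in> snd t) + of_bool (r - fst t \<in> snd t))\<^sup>2)"

lemma mod30_mult:
  assumes "mod30 t" shows "r + 30 * j \<in> snd t \<longleftrightarrow> r \<in> snd t"
proof (induction j rule: int_induct[where k = 0])
  case (step1 i)
  then show ?case using assms[unfolded mod30_def, rule_format, of "r + 30 * i"] by (simp add: algebra_simps)
next
  case (step2 i)
  then show ?case using assms[unfolded mod30_def, rule_format, of "r + 30 * (i - 1)"] by (simp add: algebra_simps)
qed simp

lemma mod30_swap_colours: "mod30 t \<Longrightarrow> mod30 (swap_colours t)"
  by (simp add: mod30_def swap_colours_def)

lemma row_of_periodic: "row_of L (y + int (length L)) = row_of L y"
proof -
  have "y + int (length L) - 1 = y - 1 + int (length L)"
    by simp
  then show ?thesis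
    unfolding row_of_def by (simp only: mod_add_self2)
qed

lemma row_of_map: "L \<noteq> [] \<Longrightarrow> row_of (map f L) y = f (row_of L y)"
  by (simp add: row_of_def nat_less_iff)

lemma row_of_in: "L \<noteq> [] \<Longrightarrow> row_of L y \<in> set L"
  by (simp add: row_of_def nat_less_iff)

lemma row_of_nth: "i < length L \<Longrightarrow> row_of L (int i + 1) = L ! i"
  by (simp add: row_of_def)

lemma paint_swap_colours: "L \<noteq> [] \<Longrightarrow> paint (map swap_colours L) = opposite (paint L)"
  by (simp add: fun_eq_iff paint_def opposite_def row_of_map swap_colours_def)

lemma mod30_row_of:
  assumes "length L = 30 * m" "m > 0" "\<forall>t\<in>set L. mod30 t"
  shows "mod30 (row_of L y)"
proof -
  have "L \<noteq> []" using assms by auto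
  then show ?thesis using row_of_in[of L y] assms(3) by blast
qed

lemma periodic_paint:
  assumes "length L = 30 * m" "m > 0" "\<forall>t\<in>set L. mod30 t"
  shows "periodic (int (length L)) (paint L)"
proof -
  have e: "x + int (length L) + a * y = x + a * y + 30 * int m"
     "x + a * (y + int (length L)) = x + a * y + 30 * (a * int m)" for x y a
    by (simp_all add: assms(1) algebra_simps)
  show ?thesis
    unfolding periodic_def paint_def row_of_periodic
    by (simp only: e mod30_mult[OF mod30_row_of[OF assms]] simp_thms)
qed

lemma sum_int_interval: "(\<Sum>y\<in>{1..int n}. f y) = (\<Sum>i<n. f (int i + 1))"
  by (rule sum.reindex_bij_witness[of _ "\<lambda>i. int i + 1" "\<lambda>y. nat (y - 1)"]) auto

lemma sum_row: "(\<Sum>y\<in>{1..int (length L)}. g (row_of L y)) = sum_list (map g L)"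
  by (simp add: sum_int_interval row_of_nth sum_list_sum_nth atLeast0LessThan)

lemma sum_mod30:
  assumes "\<And>r. f (r + 30) = f r"
  shows "(\<Sum>x\<in>{1..30 * int m}. f (x + s)) = real m * (\<Sum>r\<in>{1..30}. f r)"
  using sum_blocks[of 30 "\<lambda>x. f (x + s)" m] sum_shift[of 30 f s] assms
  by (simp add: add.commute[of _ s]) (metis add.assoc add.commute)

lemma row_sum_ind:
  assumes "length L = 30 * m" "m > 0" "\<forall>t\<in>set L. mod30 t"
  shows "(\<Sum>x\<in>{1..int (length L)}. ind (paint L) x y) = m * dens (row_of L y)"
proof -
  have "mod30 (row_of L y)"
    by (rule mod30_row_of[OF assms(1-3)])
  then show ?thesis
    using sum_mod30[of "\<lambda>r. of_bool (r \<in> snd (row_of L y))" "fst (row_of L y) * y" m]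
    by (simp add: assms(1) ind_def paint_def dens_def mod30_def)
qed

lemma row_sum_deg2:
  assumes "length L = 30 * m" "m > 0" "\<forall>t\<in>set L. mod30 t"
    and "row_of L (y + 1) = row_of L y" "row_of L (y - 1) = row_of L y"
  shows "(\<Sum>x\<in>{1..int (length L)}. ind (paint L) x y * (nb (ind (paint L)) x y)\<^sup>2) = m * dens2 (row_of L y)"
proof -
  define a i where "a = fst (row_of L y)" and "i r = (of_bool (r \<in> snd (row_of L y)) :: real)" for r
  define f where "f r = i r * (i (r + 1) + i (r - 1) + i (r + a) + i (r - a))\<^sup>2" for r
  have "mod30 (row_of L y)"
    by (rule mod30_row_of[OF assms(1-3)])
  then have per: "i (r + 30 + s) = i (r + s)" for r s
    using mod30_mult[of "row_of L y" "r + s" 1] by (simp add: i_def ac_simps)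
  have per: "f (r + 30) = f r" for r
    using per[of r 0] per[of r 1] per[of r "-1"] per[of r a] per[of r "- a"] by (simp add: f_def)
  have e: "x + 1 + a * y = x + a * y + 1" "x - 1 + a * y = x + a * y - 1"
    "x + a * (y + 1) = x + a * y + a" "x + a * (y - 1) = x + a * y - a" for x
    by (simp_all add: algebra_simps)
  have "ind (paint L) x y * (nb (ind (paint L)) x y)\<^sup>2 = f (x + a * y)" for x
    unfolding ind_def paint_def nb_def assms(4,5) f_def i_def a_def[symmetric] e by simp
  then have "(\<Sum>x\<in>{1..int (length L)}. ind (paint L) x y * (nb (ind (paint L)) x y)\<^sup>2) =
      m * (\<Sum>r\<in>{1..30}. f r)"
    using sum_mod30[of f "a * y" m] per by (simp add: assms(1))
  then show ?thesis
    by (simp only: dens2_def f_def i_def a_def)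
qed

lemma ind_nb_bounds: "0 \<le> ind c x y * (nb (ind c) x y)\<^sup>2" "ind c x y * (nb (ind c) x y)\<^sup>2 \<le> 16"
  using nb_ind_cases[of c x y] by (auto simp: ind_def)

lemma dens2_bounds: "0 \<le> dens2 t" "dens2 t \<le> 480"
proof -
  show "0 \<le> dens2 t"
    unfolding dens2_def by (intro sum_nonneg mult_nonneg_nonneg) auto
  have "of_bool a * (of_bool b + of_bool c + of_bool d + of_bool e)\<^sup>2 \<le> (16::real)" for a b c d e
    by (cases a; cases b; cases c; cases d; cases e) simp_all
  then have "dens2 t \<le> (\<Sum>r\<in>{1..30::int}. 16)"
    unfolding dens2_def by (intro sum_mono)
  then show "dens2 t \<le> 480"
    by simp
qed

definition changes :: "'a list \<Rightarrow> real" where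
  "changes L = (\<Sum>i<length L - 1. of_bool (L ! i \<noteq> L ! Suc i))"

lemma changes_Cons: "M \<noteq> [] \<Longrightarrow> changes (t # M) = of_bool (t \<noteq> hd M) + changes M"
  by (cases M) (simp_all add: changes_def sum.lessThan_Suc_shift del: sum.lessThan_Suc)

lemma changes_replicate_append: "changes (replicate n t @ M) \<le> 1 + changes M"
proof -
  have "changes (replicate n t @ M) \<le> of_bool (M \<noteq> [] \<and> t \<noteq> hd M) + changes M"
  proof (induction n)
    case 0 then show ?case by simp
  next
    case (Suc n)
    show ?case
    proof (cases "replicate n t @ M = []")
      case True
      then show ?thesis by (simp add: changes_def)
    next
      case False
      then show ?thesis using Suc changes_Cons[OF False, of t]
        by (cases n) auto
    qed
  qed
  then show ?thesis by (auto simp: of_bool_def split: if_splits)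
qed

definition expand :: "(nat \<times> 'a) list \<Rightarrow> 'a list" where
  "expand xs = concat (map (\<lambda>(n, t). replicate n t) xs)"

lemma changes_expand: "changes (expand xs) \<le> length xs"
proof (induction xs)
  case (Cons a xs)
  then show ?case
    using changes_replicate_append[of "fst a" "snd a" "expand xs"]
    by (simp add: expand_def case_prod_unfold)
qed (simp add: changes_def expand_def)

definition wsum :: "('a \<Rightarrow> real) \<Rightarrow> (nat \<times> 'a) list \<Rightarrow> real" where
  "wsum g xs = sum_list (map (\<lambda>p. real (fst p) * g (snd p)) xs)"

lemma sum_list_expand: "sum_list (map g (expand xs)) = wsum g xs"
  by (induction xs) (auto simp: expand_def wsum_def sum_list_replicate sum_list_triv)

lemma length_expand: "length (expand xs) = sum_list (map fst xs)"
  by (induction xs) (auto simp: expand_def)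

lemma map_expand: "map f (expand xs) = expand (map (map_prod id f) xs)"
  by (induction xs) (auto simp: expand_def)

lemma set_expand: "set (expand xs) \<subseteq> snd ` set xs"
  by (force simp: expand_def)

lemma sum_row_changes:
  assumes "L \<noteq> []"
  shows "(\<Sum>y\<in>{1..int (length L)}. of_bool (row_of L (y + 1) \<noteq> row_of L y)) \<le> changes L + 1"
proof -
  obtain n where n: "length L = Suc n"
    using assms by (cases L) auto
  have "row_of L (int i + 1) = L ! i" "row_of L (int i + 1 + 1) = L ! Suc i" if "i < n" for i
    using row_of_nth[of i L] row_of_nth[of "Suc i" L] that n by (simp_all add: add.commute)
  then have "(\<Sum>y\<in>{1..int (length L)}. of_bool (row_of L (y + 1) \<noteq> row_of L y)) =
     changes L + of_bool (row_of L (int n + 1 + 1) \<noteq> row_of L (int n + 1))"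
    unfolding sum_int_interval n by (simp add: changes_def n eq_commute)
  then show ?thesis by (simp add: of_bool_def)
qed

lemma deg2_sum_paint:
  assumes "length L = 30 * m" "m > 0" "\<forall>t\<in>set L. mod30 t"
  shows "\<bar>deg2_sum (int (length L)) (paint L) - m * sum_list (map dens2 L)\<bar>
     \<le> 32 * real (length L) * (changes L + 1)"
proof -
  let ?K = "int (length L)"
  define d where "d y = (of_bool (row_of L (y + 1) \<noteq> row_of L y) :: real)" for y
  define r where "r y = (\<Sum>x\<in>{1..?K}. ind (paint L) x y * (nb (ind (paint L)) x y)\<^sup>2)" for y
  have L: "L \<noteq> []" using assms by auto
  have row: "\<bar>r y - m * dens2 (row_of L y)\<bar> \<le> 16 * real (length L) * (d y + d (y - 1))" for y
  proof (cases "row_of L (y + 1) = row_of L y \<and> row_of L (y - 1) = row_of L y")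
    case True
    then show ?thesis
      using row_sum_deg2[OF assms, of y] by (simp add: r_def d_def)
  next
    case False
    have "0 \<le> r y"
      unfolding r_def by (intro sum_nonneg ind_nb_bounds)
    moreover have "r y \<le> (\<Sum>x\<in>{1..?K}. 16)"
      unfolding r_def by (intro sum_mono ind_nb_bounds)
    moreover have "0 \<le> m * dens2 (row_of L y)" "m * dens2 (row_of L y) \<le> real m * 480"
      using mult_left_mono[OF dens2_bounds(2), of "real m"] dens2_bounds(1) by simp_all
    moreover have "d y + d (y - 1) \<ge> 1"
      using False by (auto simp: d_def)
    then have "16 * real (length L) * 1 \<le> 16 * real (length L) * (d y + d (y - 1))"
      by (intro mult_left_mono) auto
    ultimately show ?thesis
      by (simp add: assms(1) abs_le_iff)
  qed
  have "deg2_sum ?K (paint L) - m * sum_list (map dens2 L) =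
     (\<Sum>y\<in>{1..?K}. r y - m * dens2 (row_of L y))"
    unfolding deg2_sum_def box_sum_def r_def sum_row[symmetric]
    by (subst sum.swap) (simp add: sum_subtractf sum_distrib_left)
  also have "\<bar>\<dots>\<bar> \<le> (\<Sum>y\<in>{1..?K}. 16 * real (length L) * (d y + d (y - 1)))"
    by (rule order_trans[OF sum_abs sum_mono[OF row]])
  also have "\<dots> = 16 * real (length L) * ((\<Sum>y\<in>{1..?K}. d y) + (\<Sum>y\<in>{1..?K}. d (y - 1)))"
    by (simp only: sum_distrib_left[symmetric] sum.distrib)
  also have "(\<Sum>y\<in>{1..?K}. d (y - 1)) = (\<Sum>y\<in>{1..?K}. d y)"
  proof -
    have "d (y + ?K) = d y" for y
      using row_of_periodic[of L "y + 1"] row_of_periodic[of L y] by (simp add: d_def ac_simps)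
    then show ?thesis
      using sum_shift[of ?K d "-1"] assms(1,2) by simp
  qed
  also have "16 * real (length L) * ((\<Sum>y\<in>{1..?K}. d y) + (\<Sum>y\<in>{1..?K}. d y)) \<le> 32 * real (length L) * (changes L + 1)"
    using mult_left_mono[OF sum_row_changes[OF L], of "32 * real (length L)"] by (simp add: d_def)
  finally show ?thesis .
qed

definition paint_set :: "pattern list \<Rightarrow> (int \<times> int) set" where
  "paint_set L = {(x, y). x \<in> {1..int (length L)} \<and> y \<in> {1..int (length L)} \<and> paint L x y}"

lemma periodic_extension_paint_set:
  assumes "length L = 30 * m" "m > 0" "\<forall>t\<in>set L. mod30 t"
  shows "periodic_extension (int (length L)) (paint_set L) = paint L"
proof -
  have "int (length L) \<ge> 1"
    using assms(1,2) by simp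
  then show ?thesis
    using wrap_in[of "int (length L)"] periodic_wrap[OF periodic_paint[OF assms]]
    by (auto simp: fun_eq_iff periodic_extension_def paint_set_def)
qed

lemma paint_set_subset: "paint_set L \<subseteq> {1..int (length L)} \<times> {1..int (length L)}"
  by (auto simp: paint_set_def)

lemma card_paint_set:
  assumes "length L = 30 * m" "m > 0" "\<forall>t\<in>set L. mod30 t"
  shows "real (card (paint_set L)) = m * sum_list (map dens L)"
proof -
  have "real (card (paint_set L)) = num_cells (int (length L)) (paint L)"
    using num_cells_lift[OF paint_set_subset, of L] periodic_extension_paint_set[OF assms] by simp
  also have "\<dots> = (\<Sum>y\<in>{1..int (length L)}. m * dens (row_of L y))"
    unfolding num_cells_def box_sum_def by (subst sum.swap) (simp only: row_sum_ind[OF assms])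
  finally show ?thesis
    by (simp add: sum_row flip: sum_distrib_left)
qed

lemma P2_paint_set:
  assumes "length L = 30 * m" "m > 0" "\<forall>t\<in>set L. mod30 t"
    and "sum_list (map dens L) = 15 * length L"
  shows "\<bar>P2 (torus2 (length L)) (paint_set L) - sum_list (map dens2 L) / (240 * real (length L))\<bar>
     \<le> 4 * (changes L + 1) / real (length L)"
proof -
  define k where "k = real (length L)"
  have k: "k > 0" "k = 30 * real m"
    using assms(1,2) by (simp_all add: k_def)
  have card: "real (card (paint_set L)) = k\<^sup>2 / 2"
    using card_paint_set[OF assms(1-3)] assms(1,4) by (simp add: k_def power2_eq_square)
  then have "paint_set L \<noteq> {}"
    using k by auto
  moreover have "length L \<ge> 2" "paint_set L \<subseteq> pverts (torus2 (length L))"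
    using assms(1,2) paint_set_subset[of L] by (auto simp: torus2_def)
  ultimately have "P2 (torus2 (length L)) (paint_set L) = deg2_sum (int (length L)) (paint L) / (8 * k\<^sup>2)"
    by (simp add: P2_torus2 periodic_extension_paint_set[OF assms(1-3)] card)
  then have "P2 (torus2 (length L)) (paint_set L) - sum_list (map dens2 L) / (240 * k) =
      (deg2_sum (int (length L)) (paint L) - m * sum_list (map dens2 L)) / (8 * k\<^sup>2)"
    using k by (simp add: field_simps power2_eq_square)
  also have "\<bar>\<dots>\<bar> \<le> (32 * k * (changes L + 1)) / (8 * k\<^sup>2)"
    using divide_right_mono[OF deg2_sum_paint[OF assms(1-3)], of "8 * k\<^sup>2"] by (simp add: k_def)
  also have "\<dots> = 4 * (changes L + 1) / k"
    using k by (simp add: field_simps power2_eq_square)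
  finally show ?thesis
    by (simp add: k_def)
qed

lemma dens_swap_colours: "dens (swap_colours t) = 30 - dens t"
proof -
  have "dens (swap_colours t) + dens t = (\<Sum>r\<in>{1..30::int}. 1)"
    unfolding dens_def sum.distrib[symmetric] by (rule sum.cong) (auto simp: swap_colours_def)
  then show ?thesis by simp
qed

lemma striped_colouring:
  fixes xs :: "(nat \<times> pattern) list"
  assumes len: "sum_list (map fst xs) = 30 * m" and m: "m > 0"
    and mod30: "\<forall>t\<in>snd ` set xs. mod30 t" and bal: "wsum dens xs = 450 * real m"
  shows "\<exists>R B. balanced_colouring (torus2 (30 * m)) R B \<and>
     \<bar>P2 (torus2 (30 * m)) R - wsum dens2 xs / (7200 * real m)\<bar> \<le> (length xs + 1) / (7 * real m) \<and>
     \<bar>P2 (torus2 (30 * m)) B - wsum (\<lambda>t. dens2 (swap_colours t)) xs / (7200 * real m)\<bar>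
        \<le> (length xs + 1) / (7 * real m)"
proof -
  define ys where "ys = map (map_prod id swap_colours) xs"
  define L where "L = expand xs"
  define L' where "L' = expand ys"
  have L: "length L = 30 * m" "\<forall>t\<in>set L. mod30 t" "sum_list (map dens L) = 15 * real (length L)"
    using len bal mod30 set_expand[of xs] unfolding L_def length_expand sum_list_expand
    by (simp, blast, simp)
  have L'_eq: "L' = map swap_colours L"
    by (simp add: L'_def ys_def L_def map_expand)
  have "sum_list (map dens L') = (\<Sum>t\<leftarrow>L. 30 - dens t)"
    by (simp add: L'_eq dens_swap_colours comp_def)
  also have "\<dots> = 30 * real (length L) - sum_list (map dens L)"
    by (simp add: sum_list_subtractf sum_list_triv)
  finally have L': "length L' = 30 * m" "\<forall>t\<in>set L'. mod30 t" "sum_list (map dens L') = 15 * real (length L')"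
    using L by (auto simp: L'_eq mod30_swap_colours)
  have "L \<noteq> []"
    using L m by auto
  have bound: "\<bar>P2 (torus2 (30 * m)) (paint_set M) - wsum dens2 zs / (7200 * real m)\<bar>
        \<le> (length xs + 1) / (7 * real m)"
    if M: "length M = 30 * m" "\<forall>t\<in>set M. mod30 t" "sum_list (map dens M) = 15 * real (length M)"
      and zs: "M = expand zs" "length zs = length xs" for M zs
  proof -
    have "\<bar>P2 (torus2 (30 * m)) (paint_set M) - wsum dens2 zs / (7200 * real m)\<bar> \<le>
        4 * (changes M + 1) / (30 * real m)"
      using P2_paint_set[OF M(1) m M(2)] M(1,3) zs(1) by (simp add: sum_list_expand)
    also have "\<dots> \<le> (30/7) * (length xs + 1) / (30 * real m)"
      using changes_expand[of zs] zs m by (intro divide_right_mono) auto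
    also have "\<dots> = (length xs + 1) / (7 * real m)"
      using m by (simp add: field_simps)
    finally show ?thesis .
  qed
  have "balanced_colouring (torus2 (30 * m)) (paint_set L) (paint_set L')"
  proof -
    have "paint L' = opposite (paint L)"
      using paint_swap_colours[OF \<open>L \<noteq> []\<close>] by (simp add: L'_eq)
    moreover have "real (card (paint_set L)) = real (card (paint_set L'))"
      using card_paint_set[OF L(1) m L(2)] card_paint_set[OF L'(1) m L'(2)] L(1,3) L'(1,3) by simp
    ultimately show ?thesis
      using L(1) L'(1) by (auto simp: balanced_colouring_def torus2_def paint_set_def opposite_def)
  qed
  moreover have "wsum dens2 ys = wsum (\<lambda>t. dens2 (swap_colours t)) xs"
    by (simp add: wsum_def ys_def comp_def)
  ultimately show ?thesis
    using bound[OF L L_def] bound[OF L' L'_def] by (auto simp: ys_def)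
qed

definition lattice_pattern :: "int \<Rightarrow> int \<Rightarrow> pattern" where
  "lattice_pattern a n = (a, {r. n dvd r})"

definition solid_pattern :: pattern where
  "solid_pattern = (1, UNIV)"

lemma interval_30: "{1..30::int} = {1,2,3,4,5,6,7,8,9,10,11,12,13,14,15,16,17,18,19,20,21,22,23,24,25,26,27,28,29,30}"
  by (rule set_eqI) (simp only: atLeastAtMost_iff insert_iff empty_iff, presburger)

lemma mod30_patterns: "mod30 solid_pattern" "mod30 (swap_colours solid_pattern)" "mod30 (lattice_pattern 1 2)" "mod30 (lattice_pattern 1 3)" "mod30 (lattice_pattern 2 5)"
  "mod30 (swap_colours (lattice_pattern 1 3))" "mod30 (swap_colours (lattice_pattern 2 5))"
  by (auto simp: mod30_def lattice_pattern_def solid_pattern_def swap_colours_def) presburger+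

lemma swap_colours_swap_colours: "swap_colours (swap_colours t) = t"
  by (simp add: swap_colours_def)

lemma dens_patterns: "dens solid_pattern = 30" "dens (lattice_pattern 1 2) = 15" "dens (lattice_pattern 1 3) = 10" "dens (lattice_pattern 2 5) = 6"
  by (simp_all add: dens_def lattice_pattern_def solid_pattern_def interval_30)

lemma dens2_patterns: "dens2 solid_pattern = 480" "dens2 (swap_colours solid_pattern) = 0"
  "dens2 (lattice_pattern 1 2) = 0" "dens2 (swap_colours (lattice_pattern 1 2)) = 0"
  "dens2 (lattice_pattern 1 3) = 0" "dens2 (swap_colours (lattice_pattern 1 3)) = 80"
  "dens2 (lattice_pattern 2 5) = 0" "dens2 (swap_colours (lattice_pattern 2 5)) = 216"
  by (simp_all add: dens2_def lattice_pattern_def solid_pattern_def swap_colours_def interval_30)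

lemma mixture_in_P_limit:
  fixes w :: "nat \<Rightarrow> real"
  assumes w: "\<And>i. i < 6 \<Longrightarrow> 0 \<le> w i" and sum: "w 0 + w 1 + w 2 + w 3 + w 4 + w 5 = 1"
  shows "(w 1 / 2 + 3 * w 2 / 4 + w 3 + w 4 / 4 + 9 * w 5 / 16,
          w 1 / 4 + 9 * w 2 / 16 + w 3 + w 4 / 2 + 3 * w 5 / 4) \<in> P_limit torus2"
  unfolding P_limit_def
proof (clarify)
  fix e :: real assume "e > 0"
  obtain q :: nat where q: "10 / e < q"
    using reals_Archimedean2 by blast
  have "q > 0"
    using q \<open>e > 0\<close> by (intro gr0I) (simp add: field_simps)
  define m where "m i = nat \<lfloor>w i * q\<rfloor>" for i
  have m: "real (m i) \<le> w i * q" "w i * q \<le> real (m i) + 1" if "i < 6" for i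
  proof -
    have "real (m i) = real_of_int \<lfloor>w i * q\<rfloor>"
      using w[OF that] by (simp add: m_def)
    then show "real (m i) \<le> w i * q" "w i * q \<le> real (m i) + 1"
      by linarith+
  qed
  have "real (m 1 + m 2 + m 3 + m 4 + m 5) \<le> (w 1 + w 2 + w 3 + w 4 + w 5) * q"
    using m(1)[of 1] m(1)[of 2] m(1)[of 3] m(1)[of 4] m(1)[of 5] by (simp add: algebra_simps)
  also have "\<dots> \<le> 1 * real q"
    using sum w[of 0] by (intro mult_right_mono) auto
  finally have "m 1 + m 2 + m 3 + m 4 + m 5 \<le> q"
    by linarith
  then obtain m0 where m0: "q = m 1 + m 2 + m 3 + m 4 + m 5 + m0"
    by (metis le_iff_add add.commute)
  let ?xs = "[(120 * m0, lattice_pattern 1 2),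
    (30 * m 1, solid_pattern), (90 * m 1, lattice_pattern 1 3),
    (45 * m 2, solid_pattern), (75 * m 2, lattice_pattern 2 5),
    (60 * m 3, solid_pattern), (60 * m 3, swap_colours solid_pattern),
    (30 * m 4, swap_colours solid_pattern), (90 * m 4, swap_colours (lattice_pattern 1 3)),
    (45 * m 5, swap_colours solid_pattern), (75 * m 5, swap_colours (lattice_pattern 2 5))]"
  have 1: "sum_list (map fst ?xs) = 30 * (4 * q)"
    by (simp add: m0)
  have 2: "\<forall>t\<in>snd ` set ?xs. mod30 t"
    by (simp add: mod30_patterns)
  have 3: "wsum dens ?xs = 450 * real (4 * q)"
    by (simp add: wsum_def dens_swap_colours dens_patterns m0)
  have "4 * q > 0"
    using \<open>q > 0\<close> by simp
  from striped_colouring[OF 1 this 2 3] obtain R B where RB: "balanced_colouring (torus2 (30 * (4 * q))) R B"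
    and R: "\<bar>P2 (torus2 (30 * (4 * q))) R - wsum dens2 ?xs / (7200 * real (4 * q))\<bar>
        \<le> (length ?xs + 1) / (7 * real (4 * q))"
    and B: "\<bar>P2 (torus2 (30 * (4 * q))) B - wsum (\<lambda>t. dens2 (swap_colours t)) ?xs / (7200 * real (4 * q))\<bar>
        \<le> (length ?xs + 1) / (7 * real (4 * q))"
    by (elim exE conjE)
  have bound: "\<bar>p - (c1 * w 1 + c2 * w 2 + c3 * w 3 + c4 * w 4 + c5 * w 5)\<bar> < e"
    if p: "\<bar>p - s / (7200 * real (4 * q))\<bar> \<le> (length ?xs + 1) / (7 * real (4 * q))"
      and s: "s = 28800 * (c1 * m 1 + c2 * m 2 + c3 * m 3 + c4 * m 4 + c5 * m 5)"
      and c: "0 \<le> c1" "c1 \<le> 1" "0 \<le> c2" "c2 \<le> 1" "0 \<le> c3" "c3 \<le> 1" "0 \<le> c4" "c4 \<le> 1" "0 \<le> c5" "c5 \<le> 1"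
    for p s c1 c2 c3 c4 c5 :: real
  proof -
    have 4: "\<bar>c * m i - c * (w i * q)\<bar> \<le> 1" if "i < 6" "0 \<le> c" "c \<le> 1" for c :: real and i
    proof -
      have "\<bar>c * m i - c * (w i * q)\<bar> = c * \<bar>m i - w i * q\<bar>"
        using that(2) by (simp add: abs_mult flip: right_diff_distrib)
      also have "\<dots> \<le> 1 * 1"
        using m[OF that(1)] that by (intro mult_mono) auto
      finally show ?thesis by simp
    qed
    have "p * q - (c1 * m 1 + c2 * m 2 + c3 * m 3 + c4 * m 4 + c5 * m 5) =
        (p - s / (7200 * real (4 * q))) * q"
      using \<open>q > 0\<close> unfolding s by (simp add: left_diff_distrib del: distrib_left_numeral)
    then have "\<bar>p * q - (c1 * m 1 + c2 * m 2 + c3 * m 3 + c4 * m 4 + c5 * m 5)\<bar> =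
        \<bar>p - s / (7200 * real (4 * q))\<bar> * q"
      by (simp add: abs_mult)
    also have "\<dots> \<le> (length ?xs + 1) / (7 * real (4 * q)) * q"
      using p by (rule mult_right_mono) simp
    also have "\<dots> \<le> 1"
      using \<open>q > 0\<close> by simp
    finally have "\<bar>p * q - (c1 * (w 1 * q) + c2 * (w 2 * q) + c3 * (w 3 * q) + c4 * (w 4 * q) + c5 * (w 5 * q))\<bar> \<le> 6"
      using 4[of 1 c1] 4[of 2 c2] 4[of 3 c3] 4[of 4 c4] 4[of 5 c5] c by simp
    then have "\<bar>(p - (c1 * w 1 + c2 * w 2 + c3 * w 3 + c4 * w 4 + c5 * w 5)) * q\<bar> \<le> 6"
      by (simp add: algebra_simps)
    then have "\<bar>p - (c1 * w 1 + c2 * w 2 + c3 * w 3 + c4 * w 4 + c5 * w 5)\<bar> * q < e * q"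
      using q \<open>e > 0\<close> by (simp add: abs_mult) (simp add: field_simps)
    then show ?thesis
      using \<open>q > 0\<close> by simp
  qed
  have "\<bar>P2 (torus2 (30 * (4 * q))) R - (w 1 / 2 + 3 * w 2 / 4 + w 3 + w 4 / 4 + 9 * w 5 / 16)\<bar> < e"
    using bound[OF R, of "1/2" "3/4" 1 "1/4" "9/16"]
    by (simp add: wsum_def dens2_patterns)
  moreover have "\<bar>P2 (torus2 (30 * (4 * q))) B - (w 1 / 4 + 9 * w 2 / 16 + w 3 + w 4 / 2 + 3 * w 5 / 4)\<bar> < e"
    using bound[OF B, of "1/4" "9/16" 1 "1/2" "3/4"]
    by (simp add: wsum_def dens2_patterns swap_colours_swap_colours)
  ultimately show "\<exists>k\<ge>1. \<exists>R B. balanced_colouring (torus2 k) R B \<and>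
     \<bar>P2 (torus2 k) R - (w 1 / 2 + 3 * w 2 / 4 + w 3 + w 4 / 4 + 9 * w 5 / 16)\<bar> < e \<and>
     \<bar>P2 (torus2 k) B - (w 1 / 4 + 9 * w 2 / 16 + w 3 + w 4 / 2 + 3 * w 5 / 4)\<bar> < e"
    using RB \<open>q > 0\<close> by (intro exI[of _ "30 * (4 * q)"] exI[of _ R] exI[of _ B] conjI) auto
qed


theorem theorem5:
  shows "P_limit torus2 =
    convex hull {(0, 0), (1/2, 1/4), (3/4, 9/16), (1, 1), (1/4, 1/2), (9/16, 3/4)}"
proof
  show "P_limit torus2 \<subseteq> convex hull {(0, 0), (1/2, 1/4), (3/4, 9/16), (1, 1), (1/4, 1/2), (9/16, 3/4)}"
    using P_limit_torus2_subset by (simp add: hull_vertices_def)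
  show "convex hull {(0, 0), (1/2, 1/4), (3/4, 9/16), (1, 1), (1/4, 1/2), (9/16, 3/4)} \<subseteq> P_limit torus2"
  proof
    fix p :: "real \<times> real"
    let ?S = "{(0, 0), (1/2, 1/4), (3/4, 9/16), (1, 1), (1/4, 1/2), (9/16, 3/4)} :: (real \<times> real) set"
    assume "p \<in> convex hull ?S"
    then obtain u where u: "\<forall>v\<in>?S. 0 \<le> u v" "sum u ?S = 1" "(\<Sum>v\<in>?S. u v *\<^sub>R v) = p"
      by (subst (asm) convex_hull_finite) auto
    define w where "w i = u ([(0, 0), (1/2, 1/4), (3/4, 9/16), (1, 1), (1/4, 1/2), (9/16, 3/4)] ! i)" for i
    have w: "w 0 = u (0, 0)" "w 1 = u (1/2, 1/4)" "w 2 = u (3/4, 9/16)" "w 3 = u (1, 1)"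
       "w 4 = u (1/4, 1/2)" "w 5 = u (9/16, 3/4)"
      by (simp_all add: w_def)
    have "w i \<ge> 0" if "i < 6" for i
    proof -
      have "[(0, 0), (1/2, 1/4), (3/4, 9/16), (1, 1), (1/4, 1/2), (9/16, 3/4)] ! i \<in>
          set [(0, 0), (1/2, 1/4), (3/4, 9/16), (1, 1), (1/4, 1/2), (9/16, 3/4) :: real \<times> real]"
        using that by (intro nth_mem) simp
      then show ?thesis
        unfolding w_def using u(1) by (metis list.set)
    qed
    moreover have "w 0 + w 1 + w 2 + w 3 + w 4 + w 5 = 1"
      using u(2) unfolding w by (simp add: add.assoc)
    moreover have "p = (w 1 / 2 + 3 * w 2 / 4 + w 3 + w 4 / 4 + 9 * w 5 / 16,
          w 1 / 4 + 9 * w 2 / 16 + w 3 + w 4 / 2 + 3 * w 5 / 4)"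
      unfolding u(3)[symmetric] w by simp
    ultimately show "p \<in> P_limit torus2"
      using mixture_in_P_limit[of w] by simp
  qed
qed

end
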